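(* Let $r\in\,]3-2\sqrt2,1[$. Then there exists an uncountable family of pairwise disjoint smooth curves in the phase space of the mapping $\widehat{\mathfrak{P}}_r$ (defined in the context), each of which is invariant under $\widehat{\mathfrak{P}}_r$, such that every orbit of $\widehat{\mathfrak{P}}_r$ starting from a point of one of these curves is quasi-periodic (and hence contained in that curve), and such that these curves form a foliation of a subset of the phase space having positive (two-dimensional) Lebesgue measure.
   Context: Let $r\in\,]0,1[$ and $\alpha=\frac{1+r}{2}$. Set $$P_1=\begin{pmatrix}-r & r\alpha & 0\\ -\alpha & \alpha^2-r & r\alpha\\ 0&0&r^2\end{pmatrix},\quad P_2=\begin{pmatrix} r&-r\alpha&0\\ \alpha&-2\alpha^2+r&\alpha\\ 0&-r\alpha&r\end{pmatrix},\quad P_3=\begin{pmatrix} r^2&0&0\\ r\alpha&\alpha^2-r&-\alpha\\ 0&r\alpha&-r\end{pmatrix}.$$ The phase space is the set of unit vectors $u=(x,y,z)\in\mathbb{S}^2$ with $x>0$, $z<0$ (equivalently, the corresponding subset of the projective plane, unit vectors being considered up to sign). The piecewise linear map $\mathfrak{P}_r$ is defined (almost everywhere) for $x>0,z<0$ by $\mathfrak{P}_r(u)=P_1u$ if $\alpha y-x>0$; $\mathfrak{P}_r(u)=P_3u$ if $\alpha y-z<0$; $\mathfrak{P}_r(u)=P_2u$ if $\alpha y-x<0$ and $\alpha y-z>0$; and $\widehat{\mathfrak{P}}_r(u)=\mathfrak{P}_r(u)/|\mathfrak{P}_r(u)|$ (the $\mathfrak{b}$-to-$\mathfrak{b}$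 mapping). An orbit $(\widehat{\mathfrak{P}}_r^n(u_0))_{n\ge0}$ is called quasi-periodic if for every $\varepsilon>0$ and every $n\geq 0$ there exists an integer $k=k(n,\varepsilon)\ge1$ such that $|\widehat{\mathfrak{P}}_r^{n}(u_0)-\widehat{\mathfrak{P}}_r^{n+k}(u_0)|\le\varepsilon$. *)

theory Defs
  imports "HOL-Analysis.Analysis"
begin

definition alpha :: "real \<Rightarrow> real" where
  "alpha r = (1 + r) / 2"

definition P1 :: "real \<Rightarrow> real^3^3" where
  "P1 r = vector
    [vector [- r, r * alpha r, 0],
     vector [- alpha r, (alpha r)\<^sup>2 - r, r * alpha r],
     vector [0, 0, r\<^sup>2]]"

definition P2 :: "real \<Rightarrow> real^3^3" where
  "P2 r = vector
    [vector [r, - r * alpha r, 0],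
     vector [alpha r, - 2 * (alpha r)\<^sup>2 + r, alpha r],
     vector [0, - r * alpha r, r]]"

definition P3 :: "real \<Rightarrow> real^3^3" where
  "P3 r = vector
    [vector [r\<^sup>2, 0, 0],
     vector [r * alpha r, (alpha r)\<^sup>2 - r, - alpha r],
     vector [0, r * alpha r, - r]]"

(* Each class of unit vectors modulo sign that meets {x > 0, z < 0} has exactly one
   representative there, so the projective and the spherical phase spaces coincide. *)
definition phase_space :: "(real^3) set" where
  "phase_space = {u \<in> sphere 0 1. u $ 1 > 0 \<and> u $ 3 < 0}"

definition region1 :: "real \<Rightarrow> (real^3) set" where
  "region1 r = {u \<in> phase_space. alpha r * u $ 2 - u $ 1 > 0}"

definition region2 :: "real \<Rightarrow> (real^3) set" where
  "region2 r = {u \<in> phase_space. alpha r * u $ 2 - u $ 1 < 0 \<and> alpha r * u $ 2 - u $ 3 > 0}"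

definition region3 :: "real \<Rightarrow> (real^3) set" where
  "region3 r = {u \<in> phase_space. alpha r * u $ 2 - u $ 3 < 0}"

(* The b-to-b mapping is partial: it is not defined on the two boundary arcs of the regions.
   All notions below require membership in bb_domain explicitly, so that the value
   chosen outside of it is irrelevant. *)
definition bb_domain :: "real \<Rightarrow> (real^3) set" where
  "bb_domain r = region1 r \<union> region2 r \<union> region3 r"

definition frakP :: "real \<Rightarrow> real^3 \<Rightarrow> real^3" where
  "frakP r u =
    (if u \<in> region1 r then P1 r *v u
     else if u \<in> region3 r then P3 r *v u
     else if u \<in> region2 r then P2 r *v u
     else undefined)"

definition hatP :: "real \<Rightarrow> real^3 \<Rightarrow> real^3" where
  "hatP r u = frakP r u /\<^sub>R norm (frakP r u)"

definition invariant_set :: "real \<Rightarrow> (real^3) set \<Rightarrow> bool" where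
  "invariant_set r C \<longleftrightarrow> C \<subseteq> bb_domain r \<and> hatP r ` C = C"

(* The first conjunct says that the whole forward orbit is defined. *)
definition quasi_periodic_orbit :: "real \<Rightarrow> real^3 \<Rightarrow> bool" where
  "quasi_periodic_orbit r u0 \<longleftrightarrow>
    (\<forall>n. (hatP r ^^ n) u0 \<in> bb_domain r) \<and>
    (\<forall>\<epsilon>>0. \<forall>n. \<exists>k\<ge>1. norm ((hatP r ^^ n) u0 - (hatP r ^^ (n + k)) u0) \<le> \<epsilon>)"

(* Class C^k, for k = n, via iterated directional derivatives; meant for open sets S
   in finite-dimensional spaces. *)
primrec Ck_on :: "nat \<Rightarrow> ('a::euclidean_space \<Rightarrow> 'b::euclidean_space) \<Rightarrow> 'a set \<Rightarrow> bool" where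
  "Ck_on 0 f S \<longleftrightarrow> continuous_on S f"
| "Ck_on (Suc n) f S \<longleftrightarrow>
    (\<forall>x\<in>S. f differentiable (at x)) \<and> (\<forall>v. Ck_on n (\<lambda>x. frechet_derivative f (at x) v) S)"

definition smooth_on :: "('a::euclidean_space \<Rightarrow> 'b::euclidean_space) \<Rightarrow> 'a set \<Rightarrow> bool" where
  "smooth_on f S \<longleftrightarrow> (\<forall>n. Ck_on n f S)"

definition smooth_embedding_on ::
    "('a::euclidean_space \<Rightarrow> 'b::euclidean_space) \<Rightarrow> 'a set \<Rightarrow> bool" where
  "smooth_embedding_on f S \<longleftrightarrow>
    open S \<and> smooth_on f S \<and> (\<forall>x\<in>S. inj (frechet_derivative f (at x))) \<and>
    (\<exists>g. homeomorphism S (f ` S) f g)"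

(* A smooth curve is a nonempty connected embedded 1-dimensional submanifold;
   it may be closed (diffeomorphic to a circle) or not. *)
definition smooth_curve :: "(real^3) set \<Rightarrow> bool" where
  "smooth_curve C \<longleftrightarrow>
    C \<noteq> {} \<and> connected C \<and>
    (\<forall>p\<in>C. \<exists>(\<gamma> :: real \<Rightarrow> real^3) a b.
       smooth_embedding_on \<gamma> {a<..<b} \<and> p \<in> \<gamma> ` {a<..<b} \<and>
       openin (top_of_set C) (\<gamma> ` {a<..<b}))"

(* Smooth foliation of a surface M by curves: M is covered by foliated charts, i.e.
   parametrizations of relatively open parts U of M by rectangles such that, for every leaf L,
   the connected components of the part of L inside U are horizontal slices (plaques).
   The existence of the charts forces M to be an embedded smooth surface. *)
definition smooth_foliation :: "(real^3) set set \<Rightarrow> (real^3) set \<Rightarrow> bool" where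
  "smooth_foliation F M \<longleftrightarrow>
    partition_on M F \<and> (\<forall>L\<in>F. smooth_curve L) \<and>
    (\<forall>p\<in>M. \<exists>(\<psi> :: real \<times> real \<Rightarrow> real^3) a b c d.
       let U = \<psi> ` ({a<..<b} \<times> {c<..<d}) in
       smooth_embedding_on \<psi> ({a<..<b} \<times> {c<..<d}) \<and> p \<in> U \<and>
       openin (top_of_set M) U \<and>
       (\<forall>L\<in>F. \<forall>K\<in>components (L \<inter> U). \<exists>s\<in>{c<..<d}. K = \<psi> ` ({a<..<b} \<times> {s})))"

(* Two-dimensional Lebesgue (surface area) measure on the unit sphere, by the cone formula
   (the volume of the solid cone over A is one third of the area of A).
   In the library emeasure is 0 on non-measurable sets, so positivity entails measurability. *)
definition sphere_area :: "(real^3) set \<Rightarrow> ennreal" where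
  "sphere_area A = 3 * emeasure lebesgue {t *\<^sub>R u | t u. 0 < t \<and> t < 1 \<and> u \<in> A}"

end

theory Submission
  imports Defs
begin

text \<open>
  The point \<open>(1, 0, -1) / sqrt 2\<close> lies in the interior of the middle region and is fixed by the
  mapping. There the mapping is given by \<open>P2\<close>, whose eigenvalues are \<open>r\<close> and a pair with product
  \<open>r\<^sup>2\<close>; that pair is non-real exactly when \<open>\<alpha>\<^sup>2 < 2 r\<close>, and since
  \<open>8 r - (1 + r)\<^sup>2 = (r - (3 - 2 sqrt 2)) (3 + 2 sqrt 2 - r)\<close>, this is where the hypothesis
  \<open>3 - 2 sqrt 2 < r\<close> enters. So \<open>P2 / r\<close> is conjugate to a rotation about the axis of the fixed
  point, and projectively the fixed point is an elliptic one with a genuinely linear rotation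
  around it.

  Explicitly, with \<open>\<omega> = sqrt (2 r - \<alpha>\<^sup>2)\<close>, the complex projective coordinate
  \<open>\<zeta> = ((x + z - \<alpha> y) + i \<omega> y) / (x - z)\<close> identifies the part \<open>x > z\<close> of the sphere with the complex
  plane and turns \<open>P2\<close> into multiplication by a number of modulus one
  (\<open>P2_lift\<close>, \<open>norm_multiplier\<close>). A disc \<open>\<bar>\<zeta>\<bar> < R\<close> lies in the middle region
  (\<open>region2_point\<close>), so it is mapped onto itself by a rotation (\<open>hatP_point\<close>). The leaves are the
  circles \<open>\<bar>\<zeta>\<bar> = \<rho>\<close> with \<open>0 < \<rho> < R\<close>. Powers of a number of modulus one come back arbitrarily
  close to 1 (\<open>power_recurrence\<close>), hence every orbit is quasi-periodic, whether the rotation angle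
  is rational or not.

  Polar coordinates \<open>\<zeta> = \<rho> cis t\<close> are foliated charts, and the solid cone over the punctured disc
  is open and nonempty, which gives positive area.
\<close>

section \<open>Functions of class C^k\<close>

lemma Ck_on_cong:
  assumes "open S" "\<And>x. x \<in> S \<Longrightarrow> f x = g x" "Ck_on n f S"
  shows "Ck_on n g S"
  using assms(2,3)
proof (induction n arbitrary: f g)
  case 0
  then show ?case using continuous_on_cong[of S S f g] by simp
next
  case (Suc n)
  have D: "(g has_derivative frechet_derivative f (at x)) (at x)" if "x \<in> S" for x
  proof (rule has_derivative_transform_within_open[OF _ \<open>open S\<close> that Suc.prems(1)])
    show "(f has_derivative frechet_derivative f (at x)) (at x)"
      using Suc.prems(2) that by (simp add: frechet_derivative_works)
  qed
  have "frechet_derivative f (at x) = frechet_derivative g (at x)" if "x \<in> S" for x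
    by (rule frechet_derivative_at[OF D[OF that]])
  then have "Ck_on n (\<lambda>x. frechet_derivative g (at x) v) S" for v
    using Suc.IH[of "\<lambda>x. frechet_derivative f (at x) v" "\<lambda>x. frechet_derivative g (at x) v"]
      Suc.prems(2) by simp
  with D show ?case by (auto simp: differentiable_def)
qed

text \<open>Directional derivatives commute with taking a component, so an induction on \<open>n\<close> carries smoothness
  of the components over to the vector-valued function.\<close>

lemma Ck_on_componentwise:
  fixes f :: "'a::euclidean_space \<Rightarrow> 'b::euclidean_space"
  assumes "open S" "\<And>b. b \<in> Basis \<Longrightarrow> Ck_on n (\<lambda>x. f x \<bullet> b) S"
  shows "Ck_on n f S"
  using assms(2)
proof (induction n arbitrary: f)
  case 0
  then show ?case using continuous_on_componentwise[of S f] by simp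
next
  case (Suc n)
  have diff: "f differentiable (at x)" if "x \<in> S" for x
    using Suc.prems that by (simp add: differentiable_componentwise_within[of f])
  have "frechet_derivative (\<lambda>x. f x \<bullet> b) (at x) v = frechet_derivative f (at x) v \<bullet> b"
    if "x \<in> S" for b v x
  proof -
    have "(f has_derivative frechet_derivative f (at x)) (at x)"
      using diff that by (simp add: frechet_derivative_works)
    then have "((\<lambda>x. f x \<bullet> b) has_derivative (\<lambda>v. frechet_derivative f (at x) v \<bullet> b)) (at x)"
      by (rule has_derivative_inner_left)
    from frechet_derivative_at[OF this] show ?thesis by metis
  qed
  then have "Ck_on n (\<lambda>x. frechet_derivative f (at x) v \<bullet> b) S" if "b \<in> Basis" for v b
    using Ck_on_cong[OF \<open>open S\<close>, of "\<lambda>x. frechet_derivative (\<lambda>x. f x \<bullet> b) (at x) v"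
        "\<lambda>x. frechet_derivative f (at x) v \<bullet> b" n]
      Suc.prems[OF that] by simp
  then have "Ck_on n (\<lambda>x. frechet_derivative f (at x) v) S" for v
    by (intro Suc.IH)
  with diff show ?case by simp
qed

text \<open>A class of functions that contains the components of all parametrizations below and is closed under
  directional derivatives. Such a closure makes smoothness a coinductive fact, which avoids product
  and chain rules for derivatives of order \<open>n\<close>.\<close>

inductive elementary_on :: "'a::euclidean_space set \<Rightarrow> ('a \<Rightarrow> real) \<Rightarrow> bool" for S where
  const: "elementary_on S (\<lambda>x. c)"
| linear: "bounded_linear f \<Longrightarrow> elementary_on S f"
| add: "elementary_on S f \<Longrightarrow> elementary_on S g \<Longrightarrow> elementary_on S (\<lambda>x. f x + g x)"
| mult: "elementary_on S f \<Longrightarrow> elementary_on S g \<Longrightarrow> elementary_on S (\<lambda>x. f x * g x)"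
| cos: "elementary_on S f \<Longrightarrow> elementary_on S (\<lambda>x. cos (f x))"
| sin: "elementary_on S f \<Longrightarrow> elementary_on S (\<lambda>x. sin (f x))"
| inverse: "elementary_on S f \<Longrightarrow> (\<And>x. x \<in> S \<Longrightarrow> f x \<noteq> 0) \<Longrightarrow> elementary_on S (\<lambda>x. inverse (f x))"
| sqrt: "elementary_on S f \<Longrightarrow> (\<And>x. x \<in> S \<Longrightarrow> f x > 0) \<Longrightarrow> elementary_on S (\<lambda>x. sqrt (f x))"

lemma elementary_on_derivative:
  assumes "elementary_on S f"
  shows "\<exists>D. (\<forall>x\<in>S. (f has_derivative D x) (at x)) \<and> (\<forall>v. elementary_on S (\<lambda>x. D x v))"
  using assms
proof induction
  case (const c)
  show ?case by (intro exI[of _ "\<lambda>x v. 0"]) (auto intro: elementary_on.const)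
next
  case (linear f)
  then show ?case
    by (intro exI[of _ "\<lambda>x. f"]) (auto intro: elementary_on.const bounded_linear_imp_has_derivative)
next
  case (add f g)
  then obtain D E where "\<forall>x\<in>S. (f has_derivative D x) (at x)" "\<forall>v. elementary_on S (\<lambda>x. D x v)"
    "\<forall>x\<in>S. (g has_derivative E x) (at x)" "\<forall>v. elementary_on S (\<lambda>x. E x v)" by blast
  then show ?case
    by (intro exI[of _ "\<lambda>x v. D x v + E x v"]) (auto intro!: elementary_on.add has_derivative_add)
next
  case (mult f g)
  then obtain D E where "\<forall>x\<in>S. (f has_derivative D x) (at x)" "\<forall>v. elementary_on S (\<lambda>x. D x v)"
    "\<forall>x\<in>S. (g has_derivative E x) (at x)" "\<forall>v. elementary_on S (\<lambda>x. E x v)" by blast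
  with mult show ?case
    by (intro exI[of _ "\<lambda>x v. f x * E x v + D x v * g x"])
      (auto intro!: elementary_on.add elementary_on.mult has_derivative_mult)
next
  case (cos f)
  then obtain D where D: "\<And>x. x \<in> S \<Longrightarrow> (f has_derivative D x) (at x)" "\<And>v. elementary_on S (\<lambda>x. D x v)"
    by blast
  have "((\<lambda>x. cos (f x)) has_derivative (\<lambda>v. (- 1) * (sin (f x) * D x v))) (at x)" if "x \<in> S" for x
    using has_derivative_cos[OF D(1)[OF that]] by (simp add: mult.commute)
  moreover have "elementary_on S (\<lambda>x. (- 1) * (sin (f x) * D x v))" for v
    by (intro elementary_on.intros cos.hyps D(2))
  ultimately show ?case by (intro exI[of _ "\<lambda>x v. (- 1) * (sin (f x) * D x v)"]) blast
next
  case (sin f)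
  then obtain D where D: "\<And>x. x \<in> S \<Longrightarrow> (f has_derivative D x) (at x)" "\<And>v. elementary_on S (\<lambda>x. D x v)"
    by blast
  have "((\<lambda>x. sin (f x)) has_derivative (\<lambda>v. cos (f x) * D x v)) (at x)" if "x \<in> S" for x
    using has_derivative_sin[OF D(1)[OF that]] by (simp add: mult.commute)
  moreover have "elementary_on S (\<lambda>x. cos (f x) * D x v)" for v
    by (intro elementary_on.intros sin.hyps D(2))
  ultimately show ?case by (intro exI[of _ "\<lambda>x v. cos (f x) * D x v"]) blast
next
  case (inverse f)
  then obtain D where D: "\<And>x. x \<in> S \<Longrightarrow> (f has_derivative D x) (at x)" "\<And>v. elementary_on S (\<lambda>x. D x v)"
    by blast
  have "((\<lambda>x. inverse (f x)) has_derivative (\<lambda>v. (- 1) * (inverse (f x) * D x v * inverse (f x)))) (at x)"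
    if "x \<in> S" for x
    using Deriv.has_derivative_inverse[OF inverse.hyps(2)[OF that] D(1)[OF that]] by simp
  moreover have "elementary_on S (\<lambda>x. (- 1) * (inverse (f x) * D x v * inverse (f x)))" for v
    by (intro elementary_on.intros inverse.hyps D(2))
  ultimately show ?case
    by (intro exI[of _ "\<lambda>x v. (- 1) * (inverse (f x) * D x v * inverse (f x))"]) blast
next
  case (sqrt f)
  then obtain D where D: "\<And>x. x \<in> S \<Longrightarrow> (f has_derivative D x) (at x)" "\<And>v. elementary_on S (\<lambda>x. D x v)"
    by blast
  have nz: "sqrt (f x) \<noteq> 0" if "x \<in> S" for x using sqrt.hyps(2)[OF that] by simp
  have "((\<lambda>x. sqrt (f x)) has_derivative (\<lambda>v. D x v * ((1 / 2) * inverse (sqrt (f x))))) (at x)"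
    if "x \<in> S" for x
    using has_derivative_real_sqrt[OF sqrt.hyps(2)[OF that] D(1)[OF that]] by (simp add: mult.commute)
  moreover have "elementary_on S (\<lambda>x. D x v * ((1 / 2) * inverse (sqrt (f x))))" for v
    by (intro elementary_on.intros sqrt.hyps D(2) nz)
  ultimately show ?case
    by (intro exI[of _ "\<lambda>x v. D x v * ((1 / 2) * inverse (sqrt (f x)))"]) blast
qed

lemma elementary_on_Ck_on:
  assumes "open S" "elementary_on S f"
  shows "Ck_on n f S"
  using assms(2)
proof (induction n arbitrary: f)
  case 0
  from elementary_on_derivative[OF 0] obtain D where "\<forall>x\<in>S. (f has_derivative D x) (at x)" by blast
  then show ?case
    by (auto intro!: continuous_at_imp_continuous_on has_derivative_continuous)
next
  case (Suc n)
  from elementary_on_derivative[OF Suc.prems] obtain D where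
    D: "\<And>x. x \<in> S \<Longrightarrow> (f has_derivative D x) (at x)" and E: "\<And>v. elementary_on S (\<lambda>x. D x v)" by blast
  have "D x = frechet_derivative f (at x)" if "x \<in> S" for x
    using D[OF that] by (rule frechet_derivative_at)
  then have "Ck_on n (\<lambda>x. frechet_derivative f (at x) v) S" for v
    using Ck_on_cong[OF \<open>open S\<close> _ Suc.IH[OF E[of v]]] by simp
  with D show ?case by (auto simp: differentiable_def)
qed

text \<open>Used with an inverse coordinate for \<open>g\<close>: then \<open>g \<circ> f\<close> is plain polar coordinates, and the derivative
  of \<open>f\<close>, which involves a normalization, need not be computed.\<close>

lemma inj_frechet_derivative_left_factor:
  assumes "f differentiable (at x)" "g differentiable (at (f x))"
    and "((\<lambda>y. g (f y)) has_derivative D) (at x)" "inj D"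
  shows "inj (frechet_derivative f (at x))"
proof -
  have "((g \<circ> f) has_derivative frechet_derivative g (at (f x)) \<circ> frechet_derivative f (at x)) (at x)"
    using assms(1,2) by (intro diff_chain_at) (simp_all add: frechet_derivative_works)
  moreover have "((g \<circ> f) has_derivative D) (at x)" using assms(3) by (simp add: o_def)
  ultimately have "frechet_derivative g (at (f x)) \<circ> frechet_derivative f (at x) = D"
    by (rule has_derivative_unique)
  with \<open>inj D\<close> show ?thesis by (metis inj_on_imageI2)
qed

section \<open>Recurrence of rotations\<close>

text \<open>By compactness of the circle some subsequence of the powers is Cauchy. Two close powers
  \<open>z ^ i\<close> and \<open>z ^ j\<close> differ by the isometry \<open>z ^ i\<close> from 1 and \<open>z ^ (j - i)\<close>.\<close>

lemma power_recurrence: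
  fixes z :: complex
  assumes "cmod z = 1" "e > 0"
  shows "\<exists>k\<ge>1. cmod (z ^ k - 1) < e"
proof -
  have "compact (sphere (0::complex) 1)" by simp
  moreover have "\<forall>n. z ^ n \<in> sphere 0 1" using assms by (simp add: norm_power)
  ultimately obtain l \<sigma> where \<sigma>: "strict_mono (\<sigma> :: nat \<Rightarrow> nat)" "((\<lambda>n. z ^ n) \<circ> \<sigma>) \<longlonglongrightarrow> l"
    unfolding compact_def by metis
  from CauchyD[OF LIMSEQ_imp_Cauchy[OF \<sigma>(2)] \<open>e > 0\<close>] obtain m where
    m: "\<And>i j. i \<ge> m \<Longrightarrow> j \<ge> m \<Longrightarrow> cmod (z ^ \<sigma> i - z ^ \<sigma> j) < e" by auto
  define k where "k = \<sigma> (Suc m) - \<sigma> m"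
  have less: "\<sigma> m < \<sigma> (Suc m)" using \<sigma>(1) by (simp add: strict_mono_def)
  then have "z ^ \<sigma> (Suc m) - z ^ \<sigma> m = z ^ \<sigma> m * (z ^ k - 1)"
    by (simp add: k_def right_diff_distrib flip: power_add)
  then have "cmod (z ^ k - 1) < e"
    using m[of "Suc m" m] assms(1) by (simp add: norm_mult norm_power)
  with less show ?thesis by (intro exI[of _ k]) (auto simp: k_def)
qed

section \<open>Polar coordinates on slit planes\<close>

text \<open>The plane without the closed ray opposite to the direction \<open>cis c\<close>: on it
  the argument has a continuous branch with values between \<open>c - \<pi>\<close> and \<open>c + \<pi>\<close>.\<close>

definition slit :: "real \<Rightarrow> complex set" where
  "slit c = {w. w * cis (- c) \<notin> \<real>\<^sub>\<le>\<^sub>0}"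

definition arg_from :: "real \<Rightarrow> complex \<Rightarrow> real" where
  "arg_from c w = c + Arg (w * cis (- c))"

lemma open_slit: "open (slit c)"
proof -
  have "slit c = (\<lambda>w. w * cis (- c)) -` (- \<real>\<^sub>\<le>\<^sub>0)" by (auto simp: slit_def)
  moreover have "continuous_on UNIV (\<lambda>w. w * cis (- c))" by (intro continuous_intros)
  ultimately show ?thesis
    by (simp add: open_vimage open_Compl)
qed

lemma continuous_on_arg_from: "continuous_on (slit c) (arg_from c)"
  unfolding arg_from_def by (intro continuous_intros) (auto simp: slit_def)

lemma rcis_in_slit:
  assumes "\<rho> > 0" "t \<in> {c - pi<..<c + pi}"
  shows "rcis \<rho> t \<in> slit c" "arg_from c (rcis \<rho> t) = t"
proof -
  have w: "rcis \<rho> t * cis (- c) = rcis \<rho> (t - c)"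
    by (simp add: rcis_def cis_mult)
  have A: "Arg (rcis \<rho> (t - c)) = t - c"
    using assms by (intro Arg_unique'[of \<rho>]) auto
  then show "arg_from c (rcis \<rho> t) = t" by (simp add: arg_from_def w)
  have "rcis \<rho> (t - c) \<notin> \<real>\<^sub>\<le>\<^sub>0"
  proof
    assume "rcis \<rho> (t - c) \<in> \<real>\<^sub>\<le>\<^sub>0"
    then have "Arg (rcis \<rho> (t - c)) = pi \<or> rcis \<rho> (t - c) = 0"
      by (metis Arg_eq_pi complex_nonpos_Reals_iff complex.expand less_eq_real_def zero_complex.sel)
    then show False using A assms by auto
  qed
  then show "rcis \<rho> t \<in> slit c" by (simp add: slit_def w)
qed

lemma slit_polar:
  assumes "w \<in> slit c"
  shows "arg_from c w \<in> {c - pi<..<c + pi}" "rcis (cmod w) (arg_from c w) = w"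
proof -
  have "Arg (w * cis (- c)) \<noteq> pi"
    using assms by (metis Arg_eq_pi complex_nonpos_Reals_iff less_eq_real_def mem_Collect_eq slit_def)
  then show "arg_from c w \<in> {c - pi<..<c + pi}"
    using Arg_bounded[of "w * cis (- c)"] by (auto simp: arg_from_def)
  have "rcis (cmod w) (arg_from c w) = rcis (cmod (w * cis (- c))) (Arg (w * cis (- c))) * cis c"
    by (simp add: rcis_def arg_from_def cis_mult norm_mult add.commute)
  also have "\<dots> = w" by (simp add: rcis_cmod_Arg cis_mult)
  finally show "rcis (cmod w) (arg_from c w) = w" .
qed

lemma rcis_image_slit:
  assumes "R \<subseteq> {0<..}"
  shows "(\<lambda>(t, \<rho>). rcis \<rho> t) ` ({c - pi<..<c + pi} \<times> R) = slit c \<inter> {w. cmod w \<in> R}"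
proof (intro set_eqI iffI)
  fix w assume "w \<in> slit c \<inter> {w. cmod w \<in> R}"
  then show "w \<in> (\<lambda>(t, \<rho>). rcis \<rho> t) ` ({c - pi<..<c + pi} \<times> R)"
    using slit_polar[of w c] by (intro image_eqI[of _ _ "(arg_from c w, cmod w)"]) auto
qed (use assms in \<open>auto intro!: rcis_in_slit\<close>)

lemma in_slit_Arg: "w \<noteq> 0 \<Longrightarrow> w \<in> slit (Arg w)"
  using rcis_in_slit(1)[of "cmod w" "Arg w" "Arg w"] by (simp add: rcis_cmod_Arg)

section \<open>The rotation coordinate\<close>

definition omega :: "real \<Rightarrow> real" where
  "omega r = sqrt (2 * r - (alpha r)\<^sup>2)"

text \<open>The functions \<open>x - z\<close> and \<open>(x + z - \<alpha> y) + i \<omega> y\<close> of \<open>(x, y, z)\<close> are eigenfunctions of \<open>P2\<close> for its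
  real and a non-real eigenvalue, both of modulus \<open>r\<close>; hence \<open>P2\<close> acts on their quotient as a rotation.\<close>

definition zeta :: "real \<Rightarrow> real^3 \<Rightarrow> complex" where
  "zeta r u = (of_real (u $ 1 + u $ 3 - alpha r * u $ 2) + \<i> * of_real (omega r * u $ 2))
     / of_real (u $ 1 - u $ 3)"

definition multiplier :: "real \<Rightarrow> complex" where
  "multiplier r = Complex (1 - (alpha r)\<^sup>2 / r) (alpha r * omega r / r)"

text \<open>The section of \<open>zeta\<close> with values in the plane \<open>x - z = 1\<close>. It is affine, which makes its continuity
  and smoothness immediate.\<close>

definition lift :: "real \<Rightarrow> complex \<Rightarrow> real^3" where
  "lift r w = vector [1 / 2, 0, - 1 / 2] + Re w *\<^sub>R vector [1 / 2, 0, 1 / 2]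
     + Im w *\<^sub>R vector [alpha r / (2 * omega r), 1 / omega r, alpha r / (2 * omega r)]"

definition point :: "real \<Rightarrow> complex \<Rightarrow> real^3" where
  "point r w = sgn (lift r w)"

text \<open>On the plane \<open>x - z = 1\<close> the inequality \<open>2 \<bar>\<alpha> y\<bar> + \<bar>x + z\<bar> < 1\<close> implies all those that define the
  middle region. For \<open>\<bar>\<zeta>\<bar> = \<rho>\<close> its left side is at most \<open>\<rho> (1 + 3 \<alpha> / \<omega>)\<close>, and this is 1 for \<open>\<rho> = radius r\<close>.\<close>

definition radius :: "real \<Rightarrow> real" where
  "radius r = omega r / (omega r + 3 * alpha r)"

definition leaf :: "real \<Rightarrow> real \<Rightarrow> (real^3) set" where
  "leaf r \<rho> = point r ` sphere 0 \<rho>"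

definition leaves_union :: "real \<Rightarrow> (real^3) set" where
  "leaves_union r = point r ` (ball 0 (radius r) - {0})"

lemma lift_nth:
  "lift r w $ 1 = (1 + Re w + alpha r * (Im w / omega r)) / 2"
  "lift r w $ 2 = Im w / omega r"
  "lift r w $ 3 = (Re w + alpha r * (Im w / omega r) - 1) / 2"
  by (simp_all add: lift_def add_divide_distrib diff_divide_distrib mult.commute)

lemma lift_axis: "lift r w $ 1 - lift r w $ 3 = 1"
proof -
  have "(1 + a + b) / 2 - (a + b - 1) / 2 = (1 :: real)" for a b by (simp add: field_simps)
  then show ?thesis unfolding lift_nth .
qed

lemma lift_nonzero: "lift r w \<noteq> 0"
  using lift_axis[of r w] by auto

lemma point_scaleR: "point r w = (1 / norm (lift r w)) *\<^sub>R lift r w"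
  by (simp add: point_def sgn_div_norm inverse_eq_divide)

lemma norm_point: "norm (point r w) = 1"
  by (simp add: point_def norm_sgn lift_nonzero)

lemma point_axis: "point r w $ 1 - point r w $ 3 > 0"
proof -
  have "point r w $ 1 - point r w $ 3 = (1 / norm (lift r w)) * (lift r w $ 1 - lift r w $ 3)"
    by (simp only: point_scaleR vector_scaleR_component real_scaleR_def right_diff_distrib)
  then show ?thesis by (simp add: lift_axis lift_nonzero)
qed

lemma continuous_on_point: "continuous_on S (point r)"
proof -
  have "continuous_on S (lift r)" unfolding lift_def by (intro continuous_intros)
  then show ?thesis unfolding point_def sgn_div_norm
    by (intro continuous_intros) (auto simp: lift_nonzero)
qed

lemma zeta_scaleR: "c \<noteq> 0 \<Longrightarrow> zeta r (c *\<^sub>R u) = zeta r u"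
proof -
  assume "c \<noteq> 0"
  have "zeta r (c *\<^sub>R u) = (of_real c * (of_real (u $ 1 + u $ 3 - alpha r * u $ 2) + \<i> * of_real (omega r * u $ 2)))
     / (of_real c * of_real (u $ 1 - u $ 3))"
    unfolding zeta_def by (simp add: algebra_simps)
  with \<open>c \<noteq> 0\<close> show ?thesis unfolding zeta_def by simp
qed

lemma zeta_differentiable:
  assumes "u $ 1 - u $ 3 \<noteq> 0"
  shows "zeta r differentiable (at u)"
proof -
  have n: "(\<lambda>u :: real^3. u $ i) differentiable (at u)" for i
    using bounded_linear_imp_differentiable bounded_linear_vec_nth by blast
  have c: "(\<lambda>u. complex_of_real (f u)) differentiable (at u)" if "f differentiable (at u)"
    for f :: "real^3 \<Rightarrow> real"
    using that has_derivative_of_real unfolding differentiable_def by blast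
  have "complex_of_real (u $ 1 - u $ 3) \<noteq> 0" using assms of_real_eq_0_iff by blast
  then show ?thesis unfolding zeta_def
    by (intro differentiable_divide differentiable_add differentiable_mult differentiable_diff
        differentiable_const c n)
qed

lemma continuous_on_zeta: "continuous_on {u. u $ 1 - u $ 3 > 0} (zeta r)"
  by (intro differentiable_imp_continuous_on differentiable_at_imp_differentiable_on zeta_differentiable)
    auto

text \<open>Stated for arbitrary polar coordinates \<open>f\<close>, \<open>g\<close> in order to serve both the parametrization of a leaf,
  where the modulus is constant, and the two-dimensional chart.\<close>

lemma smooth_on_point_rcis:
  fixes f g :: "'a::euclidean_space \<Rightarrow> real"
  assumes "open S" and f: "elementary_on S f" and g: "elementary_on S g"
  shows "smooth_on (\<lambda>x. point r (rcis (f x) (g x))) S"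
proof -
  let ?l = "\<lambda>x. lift r (rcis (f x) (g x))"
  have comp: "elementary_on S (\<lambda>x. ?l x $ i)" for i
  proof -
    have "elementary_on S (\<lambda>x. a + f x * cos (g x) * b + f x * sin (g x) * c)" for a b c
      by (intro elementary_on.intros f g)
    then show ?thesis by (simp add: lift_def)
  qed
  have norm: "norm (?l x) = sqrt (?l x $ 1 * ?l x $ 1 + ?l x $ 2 * ?l x $ 2 + ?l x $ 3 * ?l x $ 3)" for x
    by (simp add: norm_vec_def L2_set_def sum_3 power2_eq_square)
  have pos: "norm (?l x) > 0" for x by (simp add: lift_nonzero)
  have "elementary_on S (\<lambda>x. norm (?l x))"
    unfolding norm
    by (intro elementary_on.sqrt elementary_on.add elementary_on.mult comp)
      (use pos norm in \<open>metis real_sqrt_gt_0_iff\<close>)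
  then have "elementary_on S (\<lambda>x. ?l x $ i * inverse (norm (?l x)))" for i
    by (intro elementary_on.mult elementary_on.inverse comp) (simp_all add: lift_nonzero)
  then have elem: "elementary_on S (\<lambda>x. point r (rcis (f x) (g x)) $ i)" for i
    by (simp add: point_def sgn_div_norm mult.commute)
  have "Ck_on n (\<lambda>x. point r (rcis (f x) (g x)) \<bullet> b) S" if "b \<in> Basis" for n b
  proof -
    from that obtain i where "b = axis i 1" by (auto simp: Basis_vec_def)
    then have "(\<lambda>x. point r (rcis (f x) (g x)) \<bullet> b) = (\<lambda>x. point r (rcis (f x) (g x)) $ i)"
      by (simp add: inner_axis)
    then show ?thesis using elementary_on_Ck_on[OF \<open>open S\<close> elem] by simp
  qed
  then have "Ck_on n (\<lambda>x. point r (rcis (f x) (g x))) S" for n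
    by (rule Ck_on_componentwise[OF \<open>open S\<close>])
  then show ?thesis by (simp add: smooth_on_def)
qed

lemma has_derivative_rcis:
  assumes "(f has_derivative F) (at x)" "(g has_derivative G) (at x)"
  shows "((\<lambda>x. rcis (f x) (g x)) has_derivative
    (\<lambda>h. cis (g x) * (of_real (F h) + \<i> * of_real (f x * G h)))) (at x)"
  unfolding rcis_def
  using has_derivative_mult[OF has_derivative_of_real[OF assms(1)] has_derivative_cis[OF assms(2)]]
  by (simp add: algebra_simps scaleR_conv_of_real)

section \<open>The mapping near its elliptic fixed point\<close>

context
  fixes r :: real
  assumes r_gt: "3 - 2 * sqrt 2 < r" and r_lt: "r < 1"
begin

lemma r_pos: "r > 0"
proof -
  have "sqrt 2 < 3 / 2" by (rule real_less_lsqrt) (simp_all add: power2_eq_square)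
  with r_gt show ?thesis by simp
qed

lemma alpha_pos: "alpha r > 0"
  using r_pos by (simp add: alpha_def)

lemma discriminant_pos: "2 * r - (alpha r)\<^sup>2 > 0"
proof -
  have "sqrt 2 \<ge> 1" by simp
  then have "(r - (3 - 2 * sqrt 2)) * (3 + 2 * sqrt 2 - r) > 0"
    using r_gt r_lt by (intro mult_pos_pos) auto
  then have "8 * r - (1 + r)\<^sup>2 > 0"
    by (simp add: algebra_simps power2_eq_square)
  then show ?thesis by (simp add: alpha_def power2_eq_square field_simps)
qed

lemma omega_pos: "omega r > 0"
  using discriminant_pos by (simp add: omega_def)

lemma omega_square: "(omega r)\<^sup>2 = 2 * r - (alpha r)\<^sup>2"
  using discriminant_pos by (simp add: omega_def)

lemma radius_pos: "radius r > 0"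
  using omega_pos alpha_pos by (simp add: radius_def)

lemma norm_multiplier: "cmod (multiplier r) = 1"
proof -
  have "(1 - (alpha r)\<^sup>2 / r)\<^sup>2 + (alpha r * omega r / r)\<^sup>2
      = 1 - 2 * (alpha r)\<^sup>2 / r + ((alpha r)\<^sup>2 / r)\<^sup>2 + (alpha r)\<^sup>2 * (omega r)\<^sup>2 / r\<^sup>2"
    by (simp add: power2_eq_square algebra_simps)
  also have "\<dots> = 1"
    using r_pos by (simp add: omega_square) (simp add: power2_eq_square field_simps)
  finally show ?thesis by (simp add: multiplier_def cmod_def)
qed

lemma zeta_lift: "zeta r (lift r w) = w"
  unfolding zeta_def lift_axis using omega_pos
  by (simp add: complex_eq_iff) (simp add: lift_nth field_simps)

lemma zeta_point: "zeta r (point r w) = w"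
  by (simp add: point_scaleR zeta_scaleR lift_nonzero zeta_lift)

lemma point_inj: "point r w = point r w' \<longleftrightarrow> w = w'"
  using zeta_point by metis

lemma lift_zeta:
  assumes "u $ 1 - u $ 3 > 0"
  shows "lift r (zeta r u) = (1 / (u $ 1 - u $ 3)) *\<^sub>R u"
proof -
  have z: "Re (zeta r u) = (u $ 1 + u $ 3 - alpha r * u $ 2) / (u $ 1 - u $ 3)"
    "Im (zeta r u) = omega r * u $ 2 / (u $ 1 - u $ 3)"
    unfolding zeta_def by (simp_all del: of_real_diff)
  define s where "s = u $ 1 - u $ 3"
  have u1: "u $ 1 = s + u $ 3" and "s > 0" using assms by (simp_all add: s_def)
  have y: "omega r * u $ 2 / s / omega r = u $ 2 / s" using omega_pos by simp
  have "lift r (zeta r u) $ i = (1 / s) * u $ i" if "i \<in> {1, 2, 3}" for i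
    using that \<open>s > 0\<close> omega_pos unfolding lift_nth z y s_def[symmetric]
    by (auto simp: lift_nth z y u1 s_def[symmetric] divide_simps)
  then show ?thesis by (simp add: vec_eq_iff forall_3 s_def)
qed

lemma point_zeta:
  assumes "u $ 1 - u $ 3 > 0"
  shows "point r (zeta r u) = sgn u"
  using assms by (simp add: point_def lift_zeta sgn_scaleR)

lemma P2_lift: "P2 r *v lift r w = r *\<^sub>R lift r (multiplier r * w)"
proof -
  \<comment> \<open>In terms of \<open>x\<close> and \<open>y\<close> the root \<open>\<omega>\<close> occurs only through its square, a polynomial in \<open>r\<close> and \<open>\<alpha>\<close>.\<close>
  define a x y w' where "a = alpha r" and "x = Re w" and "y = Im w / omega r" and "w' = multiplier r * w"
  have Im: "Im w = omega r * y" using omega_pos by (simp add: y_def)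
  have "r * Re w' = (r - a\<^sup>2) * x - a * (omega r)\<^sup>2 * y"
    using r_pos by (simp add: w'_def multiplier_def Im a_def x_def right_diff_distrib left_diff_distrib power2_eq_square)
  then have Re': "r * Re w' = (r - a\<^sup>2) * x - a * (2 * r - a\<^sup>2) * y"
    by (simp add: omega_square a_def)
  have "Im w' = omega r * (a / r * x + (1 - a\<^sup>2 / r) * y)"
    by (simp add: w'_def multiplier_def Im a_def x_def algebra_simps)
  then have "r * (Im w' / omega r) = r * (a / r * x + (1 - a\<^sup>2 / r) * y)"
    using omega_pos by simp
  also have "\<dots> = a * x + (r - a\<^sup>2) * y"
    using r_pos by (simp add: distrib_left left_diff_distrib right_diff_distrib)
  finally have Im': "r * (Im w' / omega r) = a * x + (r - a\<^sup>2) * y" .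
  have "r * (lift r w' $ 1) = (r + r * Re w' + a * (r * (Im w' / omega r))) / 2"
    "r * (lift r w' $ 2) = r * (Im w' / omega r)"
    "r * (lift r w' $ 3) = (r * Re w' + a * (r * (Im w' / omega r)) - r) / 2"
    unfolding lift_nth a_def by (simp_all add: algebra_simps)
  then have rhs: "r * (lift r w' $ 1) = (r + r * x - r * a * y) / 2"
    "r * (lift r w' $ 2) = a * x + (r - a\<^sup>2) * y"
    "r * (lift r w' $ 3) = (r * x - r * a * y - r) / 2"
    unfolding Re' Im' by (simp_all add: algebra_simps power2_eq_square)
  have lhs: "lift r w $ 1 = (1 + x + a * y) / 2" "lift r w $ 2 = y" "lift r w $ 3 = (x + a * y - 1) / 2"
    by (simp_all add: lift_nth x_def y_def a_def)
  have "P2 r *v lift r w = r *\<^sub>R lift r w'"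
    unfolding vec_eq_iff forall_3 vector_scaleR_component real_scaleR_def rhs
    by (simp add: matrix_vector_mult_def sum_3 P2_def lhs flip: a_def)
      (simp add: algebra_simps power2_eq_square add_divide_distrib diff_divide_distrib)
  then show ?thesis by (simp add: w'_def)
qed

lemma region2_point:
  assumes "cmod w < radius r"
  shows "point r w \<in> region2 r"
proof -
  let ?a = "alpha r" and ?o = "omega r" and ?l = "lift r w"
  define t where "t = ?a * (Im w / ?o)"
  have "\<bar>t\<bar> \<le> cmod w * (?a / ?o)"
    using mult_right_mono[OF abs_Im_le_cmod[of w], of "?a / ?o"] alpha_pos omega_pos
    by (simp add: t_def abs_mult mult.commute)
  moreover have "cmod w + 3 * (cmod w * (?a / ?o)) < 1"
    using assms omega_pos alpha_pos
    by (simp add: radius_def pos_less_divide_eq divide_simps) (simp add: algebra_simps)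
  ultimately have small: "\<bar>Re w\<bar> + 3 * \<bar>t\<bar> < 1"
    using abs_Re_le_cmod[of w] by linarith
  have l: "?l $ 1 = (1 + Re w + t) / 2" "?a * ?l $ 2 = t" "?l $ 3 = (Re w + t - 1) / 2"
    by (simp_all add: lift_nth t_def)
  have "?l $ 1 > 0" "?l $ 3 < 0" "?a * ?l $ 2 - ?l $ 1 < 0" "?a * ?l $ 2 - ?l $ 3 > 0"
    unfolding l using small by (auto simp: field_simps)
  moreover define c where "c = 1 / norm ?l"
  have "c > 0" by (simp add: c_def lift_nonzero)
  moreover have p: "point r w $ i = c * ?l $ i" for i by (simp add: point_scaleR c_def)
  moreover have "?a * (c * ?l $ 2) - c * ?l $ i = c * (?a * ?l $ 2 - ?l $ i)" for i
    by (simp add: algebra_simps)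
  ultimately show ?thesis
    using norm_point[of r w] unfolding region2_def phase_space_def mem_Collect_eq p
    by (auto simp: zero_less_mult_iff mult_less_0_iff)
qed

lemma hatP_point:
  assumes "cmod w < radius r"
  shows "hatP r (point r w) = point r (multiplier r * w)"
proof -
  have 2: "point r w \<in> region2 r" using assms by (rule region2_point)
  then have "point r w \<notin> region1 r" "point r w \<notin> region3 r"
    by (auto simp: region1_def region2_def region3_def)
  with 2 have "frakP r (point r w) = P2 r *v point r w" by (simp add: frakP_def)
  also have "\<dots> = (r / norm (lift r w)) *\<^sub>R lift r (multiplier r * w)"
    by (simp add: point_scaleR matrix_vector_mult_scaleR P2_lift)
  finally have "hatP r (point r w) = sgn ((r / norm (lift r w)) *\<^sub>R lift r (multiplier r * w))"
    by (simp only: hatP_def sgn_div_norm)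
  moreover have "r / norm (lift r w) > 0" using r_pos by (simp add: lift_nonzero)
  ultimately show ?thesis by (simp only: sgn_scaleR point_def sgn_pos) simp
qed

lemma hatP_iterate_point:
  assumes "cmod w < radius r"
  shows "(hatP r ^^ n) (point r w) = point r (multiplier r ^ n * w)"
  by (induction n) (use assms in \<open>simp_all add: hatP_point norm_mult norm_power norm_multiplier mult.assoc\<close>)

lemma quasi_periodic_point:
  assumes "cmod w < radius r"
  shows "quasi_periodic_orbit r (point r w)"
  unfolding quasi_periodic_orbit_def
proof (intro conjI allI impI)
  fix n
  show "(hatP r ^^ n) (point r w) \<in> bb_domain r"
    using assms region2_point[of "multiplier r ^ n * w"]
    by (simp add: hatP_iterate_point bb_domain_def norm_mult norm_power norm_multiplier)
next
  fix e :: real and n :: nat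
  assume "e > 0"
  define v where "v = multiplier r ^ n * w"
  have "isCont (point r) v"
    using continuous_on_point[of UNIV] by (simp add: continuous_on_eq_continuous_at)
  with \<open>e > 0\<close> obtain d where "d > 0" and d: "\<And>v'. dist v' v < d \<Longrightarrow> dist (point r v') (point r v) < e"
    by (auto simp: continuous_at_eps_delta)
  \<comment> \<open>The added 1 keeps the bound meaningful on all orbits, including \<open>v = 0\<close>.\<close>
  obtain k where "k \<ge> 1" and k: "cmod (multiplier r ^ k - 1) < d / (cmod v + 1)"
    using power_recurrence[OF norm_multiplier, of "d / (cmod v + 1)"] \<open>d > 0\<close>
    by (auto simp: add_nonneg_pos)
  have "dist (multiplier r ^ k * v) v = cmod (multiplier r ^ k - 1) * cmod v"
    by (simp add: dist_norm left_diff_distrib flip: norm_mult)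
  also have "\<dots> \<le> cmod (multiplier r ^ k - 1) * (cmod v + 1)" by (simp add: mult_left_mono)
  also have "\<dots> < d" using k by (simp add: pos_less_divide_eq add_nonneg_pos)
  finally have "dist (point r (multiplier r ^ k * v)) (point r v) < e" by (rule d)
  moreover have "point r (multiplier r ^ (n + k) * w) = point r (multiplier r ^ k * v)"
    by (simp add: v_def power_add mult_ac)
  ultimately have "norm ((hatP r ^^ n) (point r w) - (hatP r ^^ (n + k)) (point r w)) < e"
    by (simp add: hatP_iterate_point[OF assms] v_def dist_norm norm_minus_commute)
  with \<open>k \<ge> 1\<close> show "\<exists>k\<ge>1. norm ((hatP r ^^ n) (point r w) - (hatP r ^^ (n + k)) (point r w)) \<le> e"
    by (meson less_imp_le)
qed

lemma sphere_multiplier: "(\<lambda>w. multiplier r * w) ` sphere 0 \<rho> = sphere 0 \<rho>"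
proof (intro set_eqI iffI)
  fix w :: complex assume "w \<in> sphere 0 \<rho>"
  then show "w \<in> (\<lambda>w. multiplier r * w) ` sphere 0 \<rho>"
    using norm_multiplier by (intro image_eqI[of _ _ "w / multiplier r"]) (auto simp: norm_divide)
qed (auto simp: norm_mult norm_multiplier)

lemma invariant_leaf:
  assumes "\<rho> < radius r"
  shows "invariant_set r (leaf r \<rho>)"
proof -
  have "hatP r ` leaf r \<rho> = point r ` (\<lambda>w. multiplier r * w) ` sphere 0 \<rho>"
    unfolding leaf_def image_image using assms by (intro image_cong) (simp_all add: hatP_point)
  moreover have "leaf r \<rho> \<subseteq> bb_domain r"
    using assms region2_point by (auto simp: leaf_def bb_domain_def)
  ultimately show ?thesis by (simp add: invariant_set_def sphere_multiplier leaf_def)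
qed

section \<open>The foliation by invariant circles\<close>

text \<open>The image of the slit domain is cut out by a condition on the continuous coordinate \<open>zeta\<close>. This yields
  relative openness of the coordinate neighbourhoods, in a leaf as well as in the union of all leaves.\<close>

lemma openin_point_slit: "openin (top_of_set (point r ` A)) (point r ` (slit c \<inter> A))"
proof -
  have "continuous_on (point r ` A) (zeta r)"
    by (rule continuous_on_subset[OF continuous_on_zeta]) (use point_axis in auto)
  from continuous_openin_preimage_gen[OF this open_slit]
  have "openin (top_of_set (point r ` A)) (point r ` A \<inter> zeta r -` slit c)" .
  moreover have "point r ` A \<inter> zeta r -` slit c = point r ` (slit c \<inter> A)"
    by (auto simp: zeta_point)
  ultimately show ?thesis by simp
qed

lemma inj_frechet_derivative_point_rcis:
  fixes f g :: "'a::euclidean_space \<Rightarrow> real"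
  assumes "elementary_on S f" "elementary_on S g" "open S" "x \<in> S" "f x > 0"
    and "(f has_derivative F) (at x)" "(g has_derivative G) (at x)"
    and inj: "\<And>h. F h = 0 \<Longrightarrow> G h = 0 \<Longrightarrow> h = 0"
  shows "inj (frechet_derivative (\<lambda>x. point r (rcis (f x) (g x))) (at x))"
proof (rule inj_frechet_derivative_left_factor)
  have "Ck_on (Suc 0) (\<lambda>x. point r (rcis (f x) (g x))) S"
    using smooth_on_point_rcis[OF assms(3,1,2)] unfolding smooth_on_def by blast
  then show "(\<lambda>x. point r (rcis (f x) (g x))) differentiable (at x)"
    using \<open>x \<in> S\<close> by simp
  show "zeta r differentiable (at (point r (rcis (f x) (g x))))"
    by (rule zeta_differentiable) (use point_axis[of r "rcis (f x) (g x)"] in simp)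
  let ?D = "\<lambda>h. cis (g x) * (of_real (F h) + \<i> * of_real (f x * G h))"
  show D: "((\<lambda>y. zeta r (point r (rcis (f y) (g y)))) has_derivative ?D) (at x)"
    unfolding zeta_point by (rule has_derivative_rcis[OF assms(6,7)])
  show "inj ?D"
    unfolding linear_injective_0[OF has_derivative_linear[OF D]]
  proof (intro allI impI)
    fix h assume "?D h = 0"
    then have "of_real (F h) + \<i> * of_real (f x * G h) = (0 :: complex)" by simp
    then have "F h = 0" "f x * G h = 0" by (simp_all add: complex_eq_iff)
    with \<open>f x > 0\<close> inj show "h = 0" by simp
  qed
qed

lemma smooth_embedding_leaf:
  assumes "\<rho> > 0"
  shows "smooth_embedding_on (\<lambda>t. point r (rcis \<rho> t)) {c - pi<..<c + pi}" (is "smooth_embedding_on ?f ?I")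
  unfolding smooth_embedding_on_def
proof (intro conjI ballI exI)
  have el: "elementary_on ?I (\<lambda>t. \<rho>)" "elementary_on ?I (\<lambda>t. t)"
    by (simp_all add: elementary_on.const elementary_on.linear)
  show "smooth_on ?f ?I" by (rule smooth_on_point_rcis) (simp_all add: el)
  show "inj (frechet_derivative ?f (at t))" if "t \<in> ?I" for t
    by (rule inj_frechet_derivative_point_rcis[where F = "\<lambda>h. 0" and G = "\<lambda>h. h", OF el _ that])
      (use assms in simp_all)
  show "homeomorphism ?I (?f ` ?I) ?f (\<lambda>u. arg_from c (zeta r u))"
  proof (rule homeomorphismI)
    show "continuous_on ?I ?f" unfolding rcis_def
      by (intro continuous_on_compose2[OF continuous_on_point[of UNIV]] continuous_intros) simp
    show "continuous_on (?f ` ?I) (\<lambda>u. arg_from c (zeta r u))"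
      by (rule continuous_on_compose2[OF continuous_on_arg_from
            continuous_on_subset[OF continuous_on_zeta]])
        (use point_axis assms in \<open>auto simp: zeta_point rcis_in_slit\<close>)
  qed (use assms in \<open>auto simp: zeta_point rcis_in_slit(2)\<close>)
qed simp

lemma smooth_embedding_chart:
  "smooth_embedding_on (\<lambda>(t, \<rho>). point r (rcis \<rho> t)) ({c - pi<..<c + pi} \<times> {0<..<R})"
    (is "smooth_embedding_on ?f ?S")
  unfolding smooth_embedding_on_def
proof (intro conjI ballI exI)
  have f: "?f = (\<lambda>x. point r (rcis (snd x) (fst x)))" by (auto simp: fun_eq_iff)
  show S: "open ?S" by (simp add: open_Times)
  have el: "elementary_on ?S snd" "elementary_on ?S fst"
    by (simp_all add: elementary_on.linear bounded_linear_fst bounded_linear_snd)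
  show "smooth_on ?f ?S" unfolding f by (rule smooth_on_point_rcis[OF S el])
  show "inj (frechet_derivative ?f (at x))" if "x \<in> ?S" for x
    unfolding f
    by (rule inj_frechet_derivative_point_rcis[where F = snd and G = fst, OF el S that])
      (use that in \<open>auto intro: bounded_linear_imp_has_derivative bounded_linear_fst bounded_linear_snd
         simp: prod_eq_iff\<close>)
  show "homeomorphism ?S (?f ` ?S) ?f (\<lambda>u. (arg_from c (zeta r u), cmod (zeta r u)))"
  proof (rule homeomorphismI)
    show "continuous_on ?S ?f" unfolding f unfolding rcis_def
      by (intro continuous_on_compose2[OF continuous_on_point[of UNIV]] continuous_intros) simp
    have z: "continuous_on (?f ` ?S) (zeta r)"
      by (rule continuous_on_subset[OF continuous_on_zeta]) (use point_axis in auto)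
    then have "continuous_on (?f ` ?S) (\<lambda>u. arg_from c (zeta r u))"
      by (rule continuous_on_compose2[OF continuous_on_arg_from])
        (auto simp: zeta_point rcis_in_slit)
    with z show "continuous_on (?f ` ?S) (\<lambda>u. (arg_from c (zeta r u), cmod (zeta r u)))"
      by (intro continuous_intros)
  qed (auto simp: zeta_point rcis_in_slit(2))
qed

lemma image_chart_slice:
  "0 < \<rho> \<Longrightarrow> (\<lambda>(t, \<rho>). point r (rcis \<rho> t)) ` ({c - pi<..<c + pi} \<times> {\<rho>}) = point r ` (slit c \<inter> sphere 0 \<rho>)"
  "(\<lambda>(t, \<rho>). point r (rcis \<rho> t)) ` ({c - pi<..<c + pi} \<times> {0<..<R}) = point r ` (slit c \<inter> (ball 0 R - {0}))"
proof -
  have *: "(\<lambda>(t, \<rho>). point r (rcis \<rho> t)) ` S = point r ` (\<lambda>(t, \<rho>). rcis \<rho> t) ` S" for S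
    by (auto simp: image_image case_prod_beta')
  show "(\<lambda>(t, \<rho>). point r (rcis \<rho> t)) ` ({c - pi<..<c + pi} \<times> {\<rho>}) = point r ` (slit c \<inter> sphere 0 \<rho>)"
    if "0 < \<rho>"
  proof -
    have "{\<rho>} \<subseteq> {0<..}" "{w. cmod w \<in> {\<rho>}} = sphere 0 \<rho>" using that by auto
    then show ?thesis unfolding * by (simp only: rcis_image_slit)
  qed
  have "{0<..<R} \<subseteq> {0<..}" "{w. cmod w \<in> {0<..<R}} = ball 0 R - {0}" by auto
  then show "(\<lambda>(t, \<rho>). point r (rcis \<rho> t)) ` ({c - pi<..<c + pi} \<times> {0<..<R}) = point r ` (slit c \<inter> (ball 0 R - {0}))"
    unfolding * by (simp only: rcis_image_slit)
qed

lemma smooth_curve_leaf: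
  assumes "\<rho> > 0"
  shows "smooth_curve (leaf r \<rho>)"
  unfolding smooth_curve_def
proof (intro conjI ballI)
  show "leaf r \<rho> \<noteq> {}" using assms by (simp add: leaf_def)
  show "connected (leaf r \<rho>)" unfolding leaf_def
    by (intro connected_continuous_image continuous_on_point connected_sphere) simp
  fix p assume "p \<in> leaf r \<rho>"
  then obtain w where w: "p = point r w" "cmod w = \<rho>" by (auto simp: leaf_def)
  define c where "c = Arg w"
  have im: "(\<lambda>t. point r (rcis \<rho> t)) ` {c - pi<..<c + pi} = point r ` (slit c \<inter> sphere 0 \<rho>)"
    unfolding image_chart_slice(1)[OF assms, symmetric] by force
  have "w \<in> slit c" using w assms in_slit_Arg[of w] by (auto simp: c_def)
  with w have p: "p \<in> (\<lambda>t. point r (rcis \<rho> t)) ` {c - pi<..<c + pi}" unfolding im by auto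
  have op: "openin (top_of_set (leaf r \<rho>)) ((\<lambda>t. point r (rcis \<rho> t)) ` {c - pi<..<c + pi})"
    unfolding im leaf_def by (rule openin_point_slit)
  show "\<exists>(\<gamma> :: real \<Rightarrow> real^3) a b. smooth_embedding_on \<gamma> {a<..<b} \<and> p \<in> \<gamma> ` {a<..<b} \<and>
       openin (top_of_set (leaf r \<rho>)) (\<gamma> ` {a<..<b})"
    by (rule exI[of _ "\<lambda>t. point r (rcis \<rho> t)"], rule exI[of _ "c - pi"], rule exI[of _ "c + pi"])
      (intro conjI smooth_embedding_leaf assms p op)
qed

lemma leaf_radius_unique: "\<rho> > 0 \<Longrightarrow> x \<in> leaf r \<rho> \<Longrightarrow> x \<in> leaf r \<rho>' \<Longrightarrow> \<rho> = \<rho>'"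
  by (auto simp: leaf_def point_inj)

lemma partition_leaves: "partition_on (leaves_union r) (leaf r ` {0<..<radius r})"
proof (rule partition_onI)
  have punctured: "ball 0 (radius r) - {0 :: complex} = (\<Union>\<rho>\<in>{0<..<radius r}. sphere 0 \<rho>)" by auto
  show "\<Union> (leaf r ` {0<..<radius r}) = leaves_union r"
    by (simp add: leaf_def leaves_union_def punctured flip: image_UN)
  show "disjnt L L'" if "L \<in> leaf r ` {0<..<radius r}" "L' \<in> leaf r ` {0<..<radius r}" "L \<noteq> L'" for L L'
  proof -
    from that obtain \<rho> \<rho>' where L: "\<rho> \<in> {0<..<radius r}" "L = leaf r \<rho>" "L' = leaf r \<rho>'" by blast
    with \<open>L \<noteq> L'\<close> have "0 < \<rho>" "\<rho> \<noteq> \<rho>'" by auto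
    with L show ?thesis using leaf_radius_unique[of \<rho> _ \<rho>'] unfolding disjnt_iff by blast
  qed
  show "{} \<notin> leaf r ` {0<..<radius r}"
    using smooth_curve_leaf by (force simp: smooth_curve_def)
qed

text \<open>A leaf meets a chart in a single slice: a circle without one point, which is connected. So it is the only
  plaque of the leaf in that chart.\<close>

lemma smooth_foliation_leaves:
  "smooth_foliation (leaf r ` {0<..<radius r}) (leaves_union r)"
  unfolding smooth_foliation_def
proof (intro conjI ballI)
  show "partition_on (leaves_union r) (leaf r ` {0<..<radius r})" by (rule partition_leaves)
  show "smooth_curve L" if "L \<in> leaf r ` {0<..<radius r}" for L
    using that smooth_curve_leaf by auto
  fix p assume "p \<in> leaves_union r"
  then obtain w where w: "p = point r w" "w \<in> ball 0 (radius r) - {0}"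
    unfolding leaves_union_def by blast
  define c where "c = Arg w"
  define \<psi> where "\<psi> = (\<lambda>(t, \<rho>). point r (rcis \<rho> t))"
  define U where "U = \<psi> ` ({c - pi<..<c + pi} \<times> {0<..<radius r})"
  have U: "U = point r ` (slit c \<inter> (ball 0 (radius r) - {0}))"
    unfolding U_def \<psi>_def by (rule image_chart_slice)
  have emb: "smooth_embedding_on \<psi> ({c - pi<..<c + pi} \<times> {0<..<radius r})"
    unfolding \<psi>_def by (rule smooth_embedding_chart)
  have p: "p \<in> U"
    using w in_slit_Arg[of w] by (auto simp: U c_def)
  have op: "openin (top_of_set (leaves_union r)) U"
    unfolding U leaves_union_def by (rule openin_point_slit)
  have slice: "\<exists>s\<in>{0<..<radius r}. K = \<psi> ` ({c - pi<..<c + pi} \<times> {s})"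
    if "L \<in> leaf r ` {0<..<radius r}" and K: "K \<in> components (L \<inter> U)" for L K
  proof -
    from that obtain s where s: "s \<in> {0<..<radius r}" and L: "L = leaf r s" by auto
    have "L \<inter> U = point r ` (slit c \<inter> sphere 0 s)"
      using s by (auto simp: L U leaf_def point_inj)
    then have eq: "L \<inter> U = \<psi> ` ({c - pi<..<c + pi} \<times> {s})"
      using image_chart_slice(1)[of s c] s by (simp add: \<psi>_def)
    have "continuous_on ({c - pi<..<c + pi} \<times> {s}) \<psi>"
      unfolding \<psi>_def case_prod_beta' rcis_def
      by (intro continuous_on_compose2[OF continuous_on_point[of UNIV]] continuous_intros) simp
    then have "connected (L \<inter> U)" unfolding eq
      by (rule connected_continuous_image) (simp add: connected_Times)
    then have "K = L \<inter> U"
      using K by (metis components_eq_sing_iff components_empty empty_iff singletonD)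
    with eq s show ?thesis by blast
  qed
  show "\<exists>(\<psi> :: real \<times> real \<Rightarrow> real^3) a b c d. let U = \<psi> ` ({a<..<b} \<times> {c<..<d}) in
       smooth_embedding_on \<psi> ({a<..<b} \<times> {c<..<d}) \<and> p \<in> U \<and>
       openin (top_of_set (leaves_union r)) U \<and>
       (\<forall>L\<in>leaf r ` {0<..<radius r}. \<forall>K\<in>components (L \<inter> U). \<exists>s\<in>{c<..<d}. K = \<psi> ` ({a<..<b} \<times> {s}))"
    unfolding Let_def
    by (rule exI[of _ \<psi>], rule exI[of _ "c - pi"], rule exI[of _ "c + pi"], rule exI[of _ 0],
        rule exI[of _ "radius r"], fold U_def)
      (intro conjI ballI emb p op slice)
qed

text \<open>The coordinate \<open>zeta\<close> is constant along rays, so the cone over the union of the leaves is described by the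
  open conditions \<open>norm v < 1\<close>, \<open>x > z\<close> and \<open>0 < \<bar>\<zeta>\<bar> < R\<close>. Measurability and positivity follow.\<close>

lemma sphere_area_leaves: "sphere_area (leaves_union r) > 0"
proof -
  define cone where "cone = {v :: real^3. norm v < 1} \<inter>
    ({v. v $ 1 - v $ 3 > 0} \<inter> zeta r -` (ball 0 (radius r) - {0}))"
  have "{t *\<^sub>R u | t u. 0 < t \<and> t < 1 \<and> u \<in> leaves_union r} = cone"
  proof (intro set_eqI iffI)
    fix v assume "v \<in> {t *\<^sub>R u | t u. 0 < t \<and> t < 1 \<and> u \<in> leaves_union r}"
    then obtain t w where tw: "v = t *\<^sub>R point r w" "0 < t" "t < 1" "w \<in> ball 0 (radius r) - {0}"
      unfolding leaves_union_def by blast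
    have "v $ 1 - v $ 3 = t * (point r w $ 1 - point r w $ 3)"
      by (simp add: tw(1) right_diff_distrib)
    then have "v $ 1 - v $ 3 > 0" using point_axis[of r w] \<open>0 < t\<close> by simp
    moreover have "zeta r v = w" using tw by (simp add: zeta_scaleR zeta_point)
    moreover have "norm v = t" using tw by (simp add: norm_point)
    ultimately show "v \<in> cone" using tw by (simp add: cone_def)
  next
    fix v assume v: "v \<in> cone"
    then have "v \<noteq> 0" by (auto simp: cone_def)
    moreover from this v have "v = norm v *\<^sub>R point r (zeta r v)"
      by (simp add: cone_def point_zeta sgn_div_norm)
    moreover from v have "point r (zeta r v) \<in> leaves_union r" "norm v < 1"
      by (auto simp: cone_def leaves_union_def)
    ultimately show "v \<in> {t *\<^sub>R u | t u. 0 < t \<and> t < 1 \<and> u \<in> leaves_union r}"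
      by (intro CollectI exI[of _ "norm v"] exI[of _ "point r (zeta r v)"]) simp
  qed
  moreover have "emeasure lebesgue cone > 0"
  proof -
    have half: "open {v :: real^3. v $ 1 - v $ 3 > 0}"
      by (intro open_Collect_less continuous_intros)
    have "open {v :: real^3. norm v < 1}"
      by (intro open_Collect_less continuous_intros)
    then have "open cone" unfolding cone_def
      by (intro open_Int continuous_open_preimage[OF continuous_on_zeta half]) (auto intro: open_delete)
    moreover have "(1 / 2) *\<^sub>R point r (of_real (radius r / 2)) \<in> cone"
      using radius_pos point_axis[of r "of_real (radius r / 2)"] 
      by (simp add: cone_def norm_point zeta_scaleR zeta_point)
    ultimately obtain p e where "e > 0" and e: "ball p e \<subseteq> cone" by (meson openE)
    have "0 < measure lborel (ball p e)" using content_ball_pos[OF \<open>e > 0\<close>] by simp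
    then have "0 < emeasure lborel (ball p e)"
      by (metis measure_def enn2real_0 less_irrefl not_gr_zero)
    also have "\<dots> \<le> emeasure lborel cone"
      using e \<open>open cone\<close> by (intro emeasure_mono) auto
    also have "\<dots> = emeasure lebesgue cone" using \<open>open cone\<close> by simp
    finally show ?thesis .
  qed
  ultimately show ?thesis by (simp add: sphere_area_def ennreal_zero_less_mult_iff)
qed

end

section \<open>The quasi-periodic foliation\<close>

theorem mainTheorem2:
  fixes r :: real
  assumes "3 - 2 * sqrt 2 < r" and "r < 1"
  shows "\<exists>(F :: (real^3) set set) M.
    uncountable F \<and> disjoint F \<and>
    (\<forall>C\<in>F. smooth_curve C \<and> C \<subseteq> phase_space \<and> invariant_set r C \<and>
       (\<forall>u\<in>C. quasi_periodic_orbit r u \<and> (\<forall>n. (hatP r ^^ n) u \<in> C))) \<and>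
    M \<subseteq> phase_space \<and> smooth_foliation F M \<and> sphere_area M > 0"
proof (intro exI conjI)
  let ?F = "leaf r ` {0<..<radius r}"
  have part: "partition_on (leaves_union r) ?F" by (rule partition_leaves[OF assms])
  have "inj_on (leaf r) {0<..<radius r}"
  proof (rule inj_onI)
    fix \<rho> \<rho>' assume \<rho>: "\<rho> \<in> {0<..<radius r}" "leaf r \<rho> = leaf r \<rho>'"
    from \<rho>(1) have "point r (of_real \<rho>) \<in> leaf r \<rho>" by (simp add: leaf_def)
    then show "\<rho> = \<rho>'" using leaf_radius_unique[OF assms, of \<rho> "point r (of_real \<rho>)" \<rho>'] \<rho> by simp
  qed
  then show "uncountable ?F"
    using radius_pos[OF assms] uncountable_open_interval countable_image_inj_on by blast
  show "disjoint ?F" using part by (rule partition_onD2)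
  have phase: "point r w \<in> phase_space" if "cmod w < radius r" for w
    using region2_point[OF assms that] by (simp add: region2_def)
  show "leaves_union r \<subseteq> phase_space" using phase by (auto simp: leaves_union_def)
  show "smooth_foliation ?F (leaves_union r)" by (rule smooth_foliation_leaves[OF assms])
  show "sphere_area (leaves_union r) > 0" by (rule sphere_area_leaves[OF assms])
  show "\<forall>C\<in>?F. smooth_curve C \<and> C \<subseteq> phase_space \<and> invariant_set r C \<and>
       (\<forall>u\<in>C. quasi_periodic_orbit r u \<and> (\<forall>n. (hatP r ^^ n) u \<in> C))"
  proof
    fix C assume "C \<in> ?F"
    then obtain \<rho> where \<rho>: "0 < \<rho>" "\<rho> < radius r" and C: "C = leaf r \<rho>" by auto
    have inv: "invariant_set r C" unfolding C by (rule invariant_leaf[OF assms \<rho>(2)])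
    have "(hatP r ^^ n) u \<in> C" if "u \<in> C" for u n
      using that inv by (induction n) (auto simp: invariant_set_def)
    moreover have "quasi_periodic_orbit r u" if "u \<in> C" for u
      using that \<rho> quasi_periodic_point[OF assms] by (auto simp: C leaf_def)
    moreover have "C \<subseteq> phase_space" using \<rho> phase by (auto simp: C leaf_def)
    ultimately show "smooth_curve C \<and> C \<subseteq> phase_space \<and> invariant_set r C \<and>
       (\<forall>u\<in>C. quasi_periodic_orbit r u \<and> (\<forall>n. (hatP r ^^ n) u \<in> C))"
      using inv smooth_curve_leaf[OF assms \<rho>(1)] C by simp
  qed
qed

end
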